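(* Let $\xi$ be a random variable with the standard normal distribution ($E\xi=0$, $E\xi^2=1$), and let $f:\mathbb{R}\to\mathbb{R}$ be a measurable function such that for all $x\in\mathbb{R}$ $$f(x+\xi)=f(x)+f(\xi)\quad P\text{-a.s.}$$ Then $f$ is linear, i.e. there is a constant $\lambda\in\mathbb{R}$ such that $f(x)=\lambda x$ for all $x\in\mathbb{R}$.
   Context: $\xi$ is defined on a complete probability space $(\Omega,\mathcal{F},P)$. "Measurable" means Lebesgue measurable. *)

theory Defs
  imports "HOL-Probability.Probability"
begin

end

theory Submission
  imports Defs
begin

text \<open>
  The standard normal density is positive everywhere, so ``almost surely in \<open>\<xi>\<close>'' is the same as
  ``for Lebesgue almost every \<open>y\<close>'': for each \<open>x\<close>, the equation \<open>f (x + y) = f x + f y\<close> holds for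
  almost every \<open>y\<close> (lemma \<open>AE_of_AE_distributed\<close>).  Since Lebesgue null sets are translation
  invariant, \<open>f (x + x' + y)\<close> can be expanded for almost every \<open>y\<close> in two ways, once by splitting
  off \<open>x + x'\<close> and once by splitting off first \<open>x\<close> and then \<open>x'\<close>.  One \<open>y\<close> at which both expansions
  are valid gives \<open>f (x + x') = f x + f x'\<close>, so \<open>f\<close> is additive without exception
  (lemma \<open>additive_if_AE_additive\<close>).

  What remains is the classical fact that a Lebesgue measurable additive function is linear.
  Such a function is bounded by some \<open>n\<close> on a subset of \<open>[0, 4]\<close> of measure more than \<open>3\<close>.
  This subset is so large that its differences cover \<open>[0, 1]\<close>, hence \<open>f\<close> is bounded by
  \<open>2 * n\<close> on \<open>[0, 1]\<close> (lemma \<open>additive_measurable_bounded\<close>).  Then \<open>f x - f 1 * x\<close> is additive,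
  has period \<open>1\<close> and is bounded on a period, so it is a bounded additive function on the whole
  line; only zero is one (lemmas \<open>linear_if_additive_bounded\<close> and
  \<open>bounded_additive_eq_0\<close>).
\<close>

text \<open>
  The set where \<open>P\<close> fails lies in the completed \<open>\<sigma>\<close>-algebra only, so its preimage under \<open>X\<close> need
  not be an event.  It differs from a set \<open>S\<close> of the original \<open>\<sigma>\<close>-algebra by a subset of a null set,
  and the law of \<open>X\<close> charges \<open>S\<close> unless \<open>S\<close> is a null set.
\<close>

lemma AE_of_AE_distributed:
  assumes X: "distributed M N X p"
    and pos: "\<And>y. y \<in> space N \<Longrightarrow> 0 < p y"
    and P: "{y \<in> space N. \<not> P y} \<in> sets (completion N)"
    and ae: "AE \<omega> in M. P (X \<omega>)"
  shows "AE y in N. P y"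
proof -
  obtain S K N' where SK: "{y \<in> space N. \<not> P y} = S \<union> K" "K \<subseteq> N'" "N' \<in> null_sets N"
      and S: "S \<in> sets N"
    using P by (rule sets_completionE)
  have meas: "X \<in> measurable M N" and p: "p \<in> borel_measurable N"
    using X by (auto simp: distributed_def)
  have "AE \<omega> in M. X \<omega> \<notin> S"
    using ae by eventually_elim (use SK(1) in auto)
  then have "AE y in distr M N X. y \<notin> S"
    using S by (subst AE_distr_iff[OF meas]) auto
  then have "AE y in density N p. y \<notin> S"
    by (simp only: distributed_distr_eq_density[OF X])
  then have "AE y in N. 0 < p y \<longrightarrow> y \<notin> S"
    using AE_density[OF p] by simp
  moreover have "AE y in N. y \<notin> N'"
    using SK(3) by (rule AE_not_in)
  ultimately show ?thesis
    using AE_space by eventually_elim (use SK pos in blast)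
qed

lemma AE_lborel_translate:
  fixes a :: "'a::euclidean_space"
  assumes "AE y in lborel. P y"
  shows "AE y in lborel. P (a + y)"
proof -
  obtain N where N: "N \<in> null_sets lborel" "{y. \<not> P y} \<subseteq> N"
    using assms by (auto simp: eventually_ae_filter)
  have "{y. y - (- a) \<in> N} \<in> null_sets lborel"
    using N(1) by (rule null_sets_translation)
  then show ?thesis
    by (rule AE_I') (use N(2) in \<open>auto simp: add.commute\<close>)
qed

lemma additive_if_AE_additive:
  fixes f :: "'a::euclidean_space \<Rightarrow> 'b::ab_group_add"
  assumes "\<And>x. AE y in lborel. f (x + y) = f x + f y"
  shows "f (x + x') = f x + f x'"
proof -
  \<comment> \<open>The rule for \<open>x\<close>, applied at the point \<open>x' + y\<close>, which is as generic as \<open>y\<close> itself.\<close>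
  have "AE y in lborel. f (x + (x' + y)) = f x + f (x' + y)"
    using AE_lborel_translate[OF assms] .
  with assms[of x'] assms[of "x + x'"]
  have "AE y in (lborel :: 'a measure). f (x + x') = f x + f x'"
    by eventually_elim (simp add: algebra_simps)
  then show ?thesis
    by (simp add: eventually_const_iff trivial_limit_def[symmetric] ae_filter_eq_bot_iff)
qed

lemma borel_measurable_lebesgue_translate:
  fixes f :: "real \<Rightarrow> real"
  assumes f: "f \<in> borel_measurable lebesgue"
  shows "(\<lambda>y. f (x + y)) \<in> borel_measurable lebesgue"
proof -
  have "(\<lambda>y. x + y) \<in> lebesgue \<rightarrow>\<^sub>M lebesgue"
    using lebesgue_affine_measurable[of "\<lambda>_. 1" x] by simp
  then show ?thesis
    using f by (rule measurable_compose)
qed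

text \<open>
  A quantitative form of Steinhaus' theorem: a set this large meets each of its translates by
  \<open>h\<close> in \<open>[0, 1]\<close>, because two disjoint copies of it would not fit into \<open>[0, 5]\<close>.
\<close>

lemma difference_of_large_set:
  fixes A :: "real set"
  assumes A: "A \<in> sets lebesgue" "A \<subseteq> {0..4}" and large: "measure lebesgue A > 3"
    and h: "h \<in> {0..1}"
  obtains a b where "a \<in> A" "b \<in> A" "a = h + b"
proof -
  have lm: "A \<in> lmeasurable"
    using A by (intro bounded_set_imp_lmeasurable) (auto intro: bounded_subset[of "{0..4}"])
  have lm': "(+) h ` A \<in> lmeasurable"
    using lm by (rule measurable_translation)
  have "A \<inter> (+) h ` A \<noteq> {}"
  proof
    assume "A \<inter> (+) h ` A = {}"
    then have "measure lebesgue (A \<union> (+) h ` A) = measure lebesgue A + measure lebesgue ((+) h ` A)"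
      using lm lm' by (simp add: measure_Un3)
    also have "\<dots> > 5"
      using large by (simp add: measure_translation)
    finally have "measure lebesgue (A \<union> (+) h ` A) > 5" .
    moreover have "measure lebesgue (A \<union> (+) h ` A) \<le> measure lebesgue {0..5::real}"
      using A h lm lm' by (intro measure_mono_fmeasurable) (fastforce simp: fmeasurableD)+
    ultimately show False
      by simp
  qed
  then show ?thesis
    using that by auto
qed

lemma additive_measurable_bounded:
  fixes f :: "real \<Rightarrow> real"
  assumes add: "\<And>x y. f (x + y) = f x + f y"
    and f: "f \<in> borel_measurable lebesgue"
  obtains K where "\<And>h. h \<in> {0..1} \<Longrightarrow> \<bar>f h\<bar> \<le> K"
proof -
  define A where "A n = {x \<in> {0..4}. \<bar>f x\<bar> \<le> real n}" for n :: nat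
  have meas: "A n \<in> sets lebesgue" for n
  proof -
    have "A n = {0..4} \<inter> (f -` {- real n..real n} \<inter> space lebesgue)"
      by (auto simp: A_def)
    also have "\<dots> \<in> sets lebesgue"
      using measurable_sets[OF f, of "{- real n..real n}"] by (intro sets.Int) auto
    finally show ?thesis .
  qed
  have un: "(\<Union>n. A n) = {0..4}"
    by (auto simp: A_def intro: real_arch_simple)
  have "(\<lambda>n. measure lebesgue (A n)) \<longlonglongrightarrow> measure lebesgue (\<Union>n. A n)"
  proof (rule Lim_measure_incseq)
    show "incseq A"
      by (rule incseq_SucI) (auto simp: A_def)
  qed (use meas un in auto)
  then have "(\<lambda>n. measure lebesgue (A n)) \<longlonglongrightarrow> 4"
    by (simp add: un)
  then have "eventually (\<lambda>n. measure lebesgue (A n) > 3) sequentially"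
    by (rule order_tendstoD) simp
  then obtain n where n: "measure lebesgue (A n) > 3"
    by (auto simp: eventually_sequentially)
  have "\<bar>f h\<bar> \<le> 2 * real n" if h: "h \<in> {0..1}" for h
  proof -
    have sub: "A n \<subseteq> {0..4}"
      by (auto simp: A_def)
    obtain a b where ab: "a \<in> A n" "b \<in> A n" "a = h + b"
      using sub by (rule difference_of_large_set[OF meas _ n h])
    then have "f h = f a - f b"
      by (simp add: add)
    with ab show ?thesis
      by (auto simp: A_def)
  qed
  then show ?thesis
    by (rule that)
qed

lemma additive_scale_nat:
  fixes f :: "real \<Rightarrow> real"
  assumes add: "\<And>x y. f (x + y) = f x + f y"
  shows "f (real n * x) = real n * f x"
proof (induction n)
  case 0
  show ?case
    using add[of 0 0] by simp
next
  case (Suc n)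
  then show ?case
    by (simp add: add distrib_right)
qed

lemma bounded_additive_eq_0:
  fixes f :: "real \<Rightarrow> real"
  assumes add: "\<And>x y. f (x + y) = f x + f y"
    and bdd: "\<And>x. \<bar>f x\<bar> \<le> K"
  shows "f x = 0"
proof (rule ccontr)
  assume "f x \<noteq> 0"
  then obtain n :: nat where "K < real n * \<bar>f x\<bar>"
    using reals_Archimedean3[of "\<bar>f x\<bar>"] by auto
  also have "\<dots> = \<bar>f (real n * x)\<bar>"
    by (simp add: additive_scale_nat[OF add] abs_mult)
  also have "\<dots> \<le> K"
    by (rule bdd)
  finally show False
    by simp
qed

lemma linear_if_additive_bounded:
  fixes f :: "real \<Rightarrow> real"
  assumes add: "\<And>x y. f (x + y) = f x + f y"
    and bdd: "\<And>h. h \<in> {0..1} \<Longrightarrow> \<bar>f h\<bar> \<le> K"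
  shows "f x = f 1 * x"
proof -
  define g where "g x = f x - f 1 * x" for x
  have g_add: "g (x + y) = g x + g y" for x y
    by (simp add: g_def add algebra_simps)
  have g_nat: "g (real n) = 0" for n
    using additive_scale_nat[of g n 1] g_add by (simp add: g_def)
  have g_int: "g (of_int k) = 0" for k
  proof (cases k)
    case (nonneg n)
    then show ?thesis
      by (simp add: g_nat)
  next
    case (neg n)
    have "g (of_int k) + g (real (Suc n)) = g 0"
      unfolding g_add[symmetric] by (simp add: neg)
    then show ?thesis
      using g_nat[of "Suc n"] g_nat[of 0] by simp
  qed
  have "\<bar>g x\<bar> \<le> K + \<bar>f 1\<bar>" for x
  proof -
    have "g x = g (of_int \<lfloor>x\<rfloor> + frac x)"
      by (simp add: frac_def)
    also have "\<dots> = g (frac x)"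
      by (simp only: g_add g_int)
    also have "\<dots> = f (frac x) - f 1 * frac x"
      by (simp add: g_def)
    also have "\<bar>\<dots>\<bar> \<le> \<bar>f (frac x)\<bar> + \<bar>f 1 * frac x\<bar>"
      by (rule abs_triangle_ineq4)
    also have "\<dots> \<le> K + \<bar>f 1\<bar>"
    proof (rule add_mono)
      show "\<bar>f (frac x)\<bar> \<le> K"
        by (intro bdd) (simp add: frac_lt_1 less_imp_le)
      show "\<bar>f 1 * frac x\<bar> \<le> \<bar>f 1\<bar>"
        by (simp add: abs_mult mult_left_le frac_lt_1 less_imp_le)
    qed
    finally show ?thesis .
  qed
  then have "g x = 0"
    using g_add by (rule bounded_additive_eq_0[rotated])
  then show ?thesis
    by (simp add: g_def)
qed

theorem theorem2p3:
  fixes M :: "'a measure" and \<xi> :: "'a \<Rightarrow> real" and f :: "real \<Rightarrow> real"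
  assumes "prob_space M" and "complete_measure M"
    and "distributed M lborel \<xi> std_normal_density"
    and "f \<in> borel_measurable lebesgue"
    and "\<And>x. AE \<omega> in M. f (x + \<xi> \<omega>) = f x + f (\<xi> \<omega>)"
  shows "\<exists>c. \<forall>x. f x = c * x"
proof -
  note f = \<open>f \<in> borel_measurable lebesgue\<close>
  have "AE y in lborel. f (x + y) = f x + f y" for x
  proof (rule AE_of_AE_distributed[OF assms(3) _ _ assms(5)])
    show "0 < ennreal (std_normal_density y)" for y
      by (simp add: normal_density_pos)
    have "{y \<in> space lebesgue. f (x + y) \<noteq> f x + f y} \<in> sets lebesgue"
      using f borel_measurable_lebesgue_translate[OF f, of x] by measurable
    then show "{y \<in> space lborel. f (x + y) \<noteq> f x + f y} \<in> sets lebesgue"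
      by simp
  qed
  then have add: "f (x + y) = f x + f y" for x y
    by (rule additive_if_AE_additive)
  obtain K where "\<And>h. h \<in> {0..1} \<Longrightarrow> \<bar>f h\<bar> \<le> K"
    using additive_measurable_bounded[OF add f] by blast
  with add have "f x = f 1 * x" for x
    by (rule linear_if_additive_bounded)
  then show ?thesis
    by blast
qed

end
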